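(* Let $p$ be an odd prime, $r\ge1$, and let $g(x)=x^{p^i+p^k}$ and $h(x)=x^{p^s+p^t}$ in $\mathbb{F}_{p^{2r}}[x]$, where $0\le i\le k<2r$ and $0\le s\le t<2r$. Let $f(x)=g(x)+(g(x))^{p^r}+h(x)-(h(x))^{p^r}$. If $f$ is planar on $\mathbb{F}_{p^{2r}}$, then either $r$ is odd and $t-s$ is even, or $r$ is even and $k-i$ is even.
   Context: A function $f$ on $\mathbb{F}_q$ is planar if $x\mapsto f(x+a)-f(x)$ is a bijection for every $a\in\mathbb{F}_q^*$. *)

theory Defs
  imports
    "HOL-Computational_Algebra.Computational_Algebra"
    "HOL-Library.Cardinality"
begin

definition planar :: "('a::{field,finite} \<Rightarrow> 'a) \<Rightarrow> bool" where
  "planar f \<longleftrightarrow> (\<forall>a. a \<noteq> 0 \<longrightarrow> bij (\<lambda>x. f (x + a) - f x))"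

end

theory Submission
  imports Defs
begin

text \<open>
  The difference \<open>f (x + 1) - f x - f 1\<close> equals \<open>A + A^(p^r) + B - B^(p^r)\<close> with
  \<open>A = x^(p^i) + x^(p^k)\<close> and \<open>B = x^(p^s) + x^(p^t)\<close>. Evaluate it at a nonzero \<open>x\<close> with
  \<open>x^p = -x\<close>, which exists because \<open>2 (p - 1)\<close> divides \<open>p^(2 r) - 1\<close>. There every iterate
  of the Frobenius map acts as a sign, so the difference is \<open>2 A\<close> for even \<open>r\<close> and
  \<open>2 B\<close> for odd \<open>r\<close>. If \<open>k - i\<close>, respectively \<open>t - s\<close>, were odd, it would vanish, and
  \<open>f (x + 1) - f x\<close> would take the same value at \<open>x\<close> and at \<open>0\<close>.
\<close>

text \<open>Translation by 1 permutes the field, so comparing sums over all elements shows that the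
  field size vanishes in the field; the prime characteristic therefore divides
  \<open>p ^ n\<close>.\<close>

lemma CHAR_eq_of_card_prime_power:
  assumes "prime p" and "CARD('a::{field,finite}) = p ^ n"
  shows "CHAR('a) = p"
proof -
  have "prime CHAR('a)"
    by (intro prime_CHAR_semidom finite_imp_CHAR_pos) simp
  moreover have "CHAR('a) dvd p ^ n"
  proof -
    have "(\<Sum>y\<in>UNIV. y + 1) = (\<Sum>y\<in>UNIV. y :: 'a)"
      by (rule sum.reindex_bij_betw) (rule bij_plus_right)
    then have "of_nat CARD('a) = (0 :: 'a)"
      by (simp add: sum.distrib)
    then show ?thesis
      by (simp only: of_nat_eq_0_iff_char_dvd assms(2))
  qed
  ultimately show ?thesis
    using assms(1) by (metis prime_dvd_power primes_dvd_imp_eq)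
qed

lemma power_card_minus_one_eq_one:
  fixes x :: "'a::{field,finite}"
  assumes "x \<noteq> 0"
  shows "x ^ (CARD('a) - 1) = 1"
proof -
  have "bij_betw ((*) x) (UNIV - {0}) (UNIV - {0})"
    by (rule bij_betwI[of _ _ _ "\<lambda>y. y / x"]) (use assms in auto)
  then have "(\<Prod>y\<in>UNIV - {0}. x * y) = (\<Prod>y\<in>UNIV - {0}. y)"
    by (rule prod.reindex_bij_betw)
  then have "x ^ (CARD('a) - 1) * \<Prod>(UNIV - {0 :: 'a}) = \<Prod>(UNIV - {0})"
    by (simp add: prod.distrib)
  then show ?thesis
    by simp
qed

text \<open>With \<open>CARD('a) - 1 = 2 * n * m\<close>, the polynomial \<open>q\<close> has too
  few roots to contain all nonzero elements. A nonzero non-root \<open>y\<close> has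
  \<open>y ^ (n * m)\<close> a square root of 1 other than 1, and \<open>y ^ m\<close> is the
  witness.\<close>

lemma exists_power_eq_minus_one:
  assumes "2 * n dvd CARD('a::{field,finite}) - 1"
  shows "\<exists>x :: 'a. x ^ n = - 1"
proof -
  obtain m where m: "CARD('a) - 1 = 2 * n * m"
    using assms by blast
  \<comment> \<open>Two distinct elements make \<open>CARD('a) - 1\<close> positive, which excludes
    \<open>n = 0\<close> and \<open>m = 0\<close>.\<close>
  have "card {0, 1 :: 'a} \<le> CARD('a)"
    by (intro card_mono) auto
  then have pos: "n * m > 0"
    using m by (cases "n * m = 0") auto
  define q :: "'a poly" where "q = monom 1 (n * m) - 1"
  have coeff_q: "coeff q (n * m) = 1"
    using pos by (simp add: q_def)
  have "degree q \<le> n * m"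
    unfolding q_def by (intro degree_diff_le) (auto simp: degree_monom_le)
  moreover have "q \<noteq> 0"
    using coeff_q by auto
  ultimately have "card {y. poly q y = 0} \<le> n * m"
    using card_poly_roots_bound[of q] by simp
  moreover have "card (UNIV - {0 :: 'a}) = 2 * n * m"
    using m by simp
  ultimately have "card {y. poly q y = 0} < card (UNIV - {0 :: 'a})"
    using pos by linarith
  then have "\<not> UNIV - {0} \<subseteq> {y. poly q y = 0}"
    using card_mono[of "{y. poly q y = 0}" "UNIV - {0}"] by auto
  then obtain y where "y \<noteq> 0" "poly q y \<noteq> 0"
    by blast
  then have y: "y \<noteq> 0" "y ^ (n * m) \<noteq> 1"
    by (simp_all add: q_def poly_monom)
  have "(y ^ (n * m)) ^ 2 = 1"
    using power_card_minus_one_eq_one[OF y(1)] m by (simp add: mult_ac flip: power_mult)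
  then have "y ^ (n * m) = - 1"
    using y(2) by (simp add: power2_eq_1_iff)
  then show ?thesis
    by (intro exI[of _ "y ^ m"]) (simp add: mult.commute flip: power_mult)
qed

text \<open>The extra factor 2 comes from the even \<open>p + 1\<close> in \<open>p ^ 2 - 1\<close>,
  which divides \<open>(p ^ 2) ^ r - 1\<close>.\<close>

lemma two_times_pred_dvd_even_power_pred:
  fixes p r :: nat
  assumes "odd p"
  shows "2 * (p - 1) dvd p ^ (2 * r) - 1"
proof -
  have "(p - 1) * (p + 1) = p ^ 2 - 1"
    by (simp add: algebra_simps power2_eq_square)
  moreover have "2 * (p - 1) dvd (p - 1) * (p + 1)"
    using assms by (subst mult.commute) (intro mult_dvd_mono, auto)
  moreover have "p ^ 2 - 1 dvd (p ^ 2) ^ r - 1"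
  proof -
    have "int (p ^ 2 - 1) dvd int ((p ^ 2) ^ r - 1)"
      using assms power_diff_1_eq[of "int p ^ 2" r] by (simp add: of_nat_diff odd_pos Suc_le_eq)
    then show ?thesis
      by simp
  qed
  ultimately show ?thesis
    by (metis dvd_trans power_mult)
qed

lemma power_prime_power_of_anti_fixed:
  fixes x :: "'a::comm_ring_1"
  assumes "odd p" and "x ^ p = - x"
  shows "x ^ (p ^ n) = (- 1) ^ n * x"
proof (induction n)
  case (Suc n)
  have "x ^ (p ^ Suc n) = (x ^ (p ^ n)) ^ p"
    by (simp add: mult.commute flip: power_mult)
  also have "\<dots> = ((- 1) ^ p) ^ n * x ^ p"
    by (simp add: Suc power_mult_distrib mult.commute flip: power_mult)
  finally show ?case
    using assms by simp
qed simp

theorem theorem11: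
  fixes p r i k s t :: nat
    and f g h :: "'a::{field,finite} poly"
  assumes "prime p" and "odd p" and "r \<ge> 1"
    and "CARD('a) = p ^ (2 * r)"
    and "i \<le> k" and "k < 2 * r"
    and "s \<le> t" and "t < 2 * r"
    and "g = monom 1 (p ^ i + p ^ k)"
    and "h = monom 1 (p ^ s + p ^ t)"
    and "f = g + g ^ (p ^ r) + h - h ^ (p ^ r)"
    and "planar (poly f)"
  shows "(odd r \<and> even (t - s)) \<or> (even r \<and> even (k - i))"
proof (rule ccontr)
  assume neg: "\<not> ?thesis"
  have char: "CHAR('a) = p"
    using assms(1,4) by (rule CHAR_eq_of_card_prime_power)
  have frob: "(a + b) ^ (p ^ n) = a ^ (p ^ n) + b ^ (p ^ n)" for a b :: 'a and n
    using freshmans_dream'[where ?'a = 'a] char assms(1) by blast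
  obtain x :: 'a where x: "x ^ (p - 1) = - 1"
    using exists_power_eq_minus_one two_times_pred_dvd_even_power_pred[OF assms(2)] assms(4)
    by metis
  have "p > 1"
    using assms(1) by (rule prime_gt_1_nat)
  then have "x \<noteq> 0"
    using x by (auto simp: power_0_left split: if_splits)
  have "x ^ p = x ^ (p - 1) * x"
    using \<open>p > 1\<close> by (simp flip: power_Suc2)
  then have xp: "x ^ p = - x"
    using x by simp
  have iter: "x ^ (p ^ n) = (- 1) ^ n * x" for n
    using assms(2) xp by (rule power_prime_power_of_anti_fixed)
  \<comment> \<open>By \<open>iter\<close> this is \<open>x ^ (p ^ m) + x ^ (p ^ n)\<close>, the sum
    of the cross terms in \<open>shift\<close>.\<close>
  define D where "D m n = ((- 1) ^ m + (- 1) ^ n) * x" for m n :: nat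
  have D_iter: "D m n ^ (p ^ r) = (- 1) ^ r * D m n" for m n
  proof -
    have "((- 1) ^ m * x) ^ (p ^ r) = (- 1) ^ r * ((- 1) ^ m * x)" for m
    proof -
      \<comment> \<open>The exponent \<open>p ^ r\<close> is odd, so signs are fixed and only
        \<open>x\<close> contributes the factor \<open>(- 1) ^ r\<close>.\<close>
      have "((- 1 :: 'a) ^ m) ^ (p ^ r) = (- 1) ^ m"
        using assms(2) by (cases "even m") auto
      then show ?thesis
        by (simp add: power_mult_distrib iter)
    qed
    then show ?thesis
      by (simp add: D_def distrib_right distrib_left frob)
  qed
  have shift: "(x + 1) ^ (p ^ m + p ^ n) = x ^ (p ^ m + p ^ n) + 1 + D m n" for m n
    by (simp add: power_add frob iter D_def algebra_simps)
  have "poly f (x + 1) - poly f x - poly f 1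
      = D i k + (- 1) ^ r * D i k + (D s t - (- 1) ^ r * D s t)"
    by (simp add: assms(9-11) poly_monom shift frob D_iter)
  also have "\<dots> = 0"
  proof (cases "even r")
    case True
    then have "odd (k - i)"
      using neg by simp
    \<comment> \<open>Exponents of opposite parity give opposite signs; the two \<open>D s t\<close>
      terms cancel because \<open>r\<close> is even.\<close>
    then have "D i k = 0"
      using assms(5) by (cases "even i") (auto simp: D_def)
    then show ?thesis
      using True by simp
  next
    case False
    then have "odd (t - s)"
      using neg by simp
    then have "D s t = 0"
      using assms(7) by (cases "even s") (auto simp: D_def)
    then show ?thesis
      using False by simp
  qed
  \<comment> \<open>All exponents are positive, so \<open>poly f 0 = 0\<close> and
    \<open>poly f 1\<close> is the difference at 0.\<close>
  finally have "poly f (x + 1) - poly f x = poly f (0 + 1) - poly f 0"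
    using \<open>p > 1\<close> by (simp add: assms(9-11) poly_monom power_0_left)
  moreover have "inj (\<lambda>y. poly f (y + 1) - poly f y)"
    using assms(12) by (simp add: planar_def bij_is_inj)
  ultimately have "x = 0"
    by (metis (mono_tags, lifting) injD)
  with \<open>x \<noteq> 0\<close> show False ..
qed

end
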